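(* Let $(\mathcal T,\otimes,\mathbf 1)$ be a tensor triangulated category which has only a set of radical thick tensor ideals. Then the radical thick tensor ideals of $\mathcal T$, ordered by inclusion, form a coherent frame. Its finite elements are the principal radical thick tensor ideals, i.e. those of the form $\sqrt a$ for some object $a\in\mathcal T$.
   Context: A tensor triangulated category is a triangulated category with a symmetric monoidal structure $\otimes$ with unit $\mathbf 1$ such that tensoring with any object is an exact (triangulated) endofunctor. A thick tensor ideal is a full triangulated subcategory $I$ closed under finite sums, closed under direct summands ($a\oplus b\in I$ implies $a,b\in I$), and such that $a\in I$, $b\in\mathcal T$ imply $a\otimes b\in I$. Its radical is $\sqrt I=\{a\in\mathcal T\mid \exists n\in\mathbb N,\ a^{\otimes n}\in I\}$; $I$ is radical if $I=\sqrt I$. For a set $S$ of objects, $\sqrt S$ denotes the radical of the smallest thick tensor ideal containing $S$, and $\sqrt a=\sqrt{\{a\}}$. A frame is a complete lattice in which finite meets distribute over arbitrary joins. An element $c$ is finite if $c\le\bigvee S$ implies $c\le\bigvee K$ for some finite $K\subset S$. A frame is coherent if every element is a join of finite elements and the finite elements form a sublattice (equivalently, the top element is finite and the meet of two finite elements is finite). *)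

theory Defs
  imports "HOL-Algebra.Group"
begin

section \<open>Categories and functors\<close>

record ('o, 'm) cat =
  Ob  :: "'o set"
  Ar  :: "'m set"
  src :: "'m \<Rightarrow> 'o"
  tgt :: "'m \<Rightarrow> 'o"
  idn :: "'o \<Rightarrow> 'm"
  cmp :: "'m \<Rightarrow> 'm \<Rightarrow> 'm" (infixl "\<cdot>\<index>" 70)

definition Hom :: "('o, 'm, 'z) cat_scheme \<Rightarrow> 'o \<Rightarrow> 'o \<Rightarrow> 'm set" where
  "Hom C a b = {f \<in> Ar C. src C f = a \<and> tgt C f = b}"

text \<open>Composition is written in the usual order: \<open>g \<cdot> f\<close> is first \<open>f\<close>, then \<open>g\<close>.\<close>

locale category =
  fixes C :: "('o, 'm, 'z) cat_scheme" (structure)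
  assumes src_closed: "f \<in> Ar C \<Longrightarrow> src C f \<in> Ob C"
    and tgt_closed: "f \<in> Ar C \<Longrightarrow> tgt C f \<in> Ob C"
    and idn_hom: "a \<in> Ob C \<Longrightarrow> idn C a \<in> Hom C a a"
    and cmp_hom: "\<lbrakk>f \<in> Hom C a b; g \<in> Hom C b c\<rbrakk> \<Longrightarrow> g \<cdot> f \<in> Hom C a c"
    and cmp_idn_right: "f \<in> Hom C a b \<Longrightarrow> f \<cdot> idn C a = f"
    and cmp_idn_left: "f \<in> Hom C a b \<Longrightarrow> idn C b \<cdot> f = f"
    and cmp_assoc: "\<lbrakk>f \<in> Hom C a b; g \<in> Hom C b c; h \<in> Hom C c d\<rbrakk>
        \<Longrightarrow> (h \<cdot> g) \<cdot> f = h \<cdot> (g \<cdot> f)"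

definition iso_arrow :: "('o, 'm, 'z) cat_scheme \<Rightarrow> 'm \<Rightarrow> bool" where
  "iso_arrow C f \<longleftrightarrow> f \<in> Ar C \<and>
     (\<exists>g \<in> Hom C (tgt C f) (src C f).
        g \<cdot>\<^bsub>C\<^esub> f = idn C (src C f) \<and> f \<cdot>\<^bsub>C\<^esub> g = idn C (tgt C f))"

definition iso_objects :: "('o, 'm, 'z) cat_scheme \<Rightarrow> 'o \<Rightarrow> 'o \<Rightarrow> bool" where
  "iso_objects C a b \<longleftrightarrow> (\<exists>f \<in> Hom C a b. iso_arrow C f)"

definition prod_cat ::
  "('o, 'm, 'y) cat_scheme \<Rightarrow> ('p, 'n, 'z) cat_scheme \<Rightarrow> ('o \<times> 'p, 'm \<times> 'n) cat" where
  "prod_cat C D = \<lparr>Ob = Ob C \<times> Ob D, Ar = Ar C \<times> Ar D,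
     src = (\<lambda>(f, g). (src C f, src D g)), tgt = (\<lambda>(f, g). (tgt C f, tgt D g)),
     idn = (\<lambda>(a, b). (idn C a, idn D b)),
     cmp = (\<lambda>(g, g') (f, f'). (g \<cdot>\<^bsub>C\<^esub> f, g' \<cdot>\<^bsub>D\<^esub> f'))\<rparr>"

record ('o, 'm, 'p, 'n) fct =
  fob :: "'o \<Rightarrow> 'p"
  far :: "'m \<Rightarrow> 'n"

definition id_fct :: "('o, 'm, 'o, 'm) fct" where
  "id_fct = \<lparr>fob = (\<lambda>a. a), far = (\<lambda>f. f)\<rparr>"

definition comp_fct ::
  "('p, 'n, 'q, 'k) fct \<Rightarrow> ('o, 'm, 'p, 'n) fct \<Rightarrow> ('o, 'm, 'q, 'k) fct" where
  "comp_fct G F = \<lparr>fob = (\<lambda>a. fob G (fob F a)), far = (\<lambda>f. far G (far F f))\<rparr>"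

locale cat_functor = source: category C + target: category D
  for C :: "('o, 'm, 'y) cat_scheme" and D :: "('p, 'n, 'z) cat_scheme" +
  fixes F :: "('o, 'm, 'p, 'n) fct"
  assumes fob_closed: "a \<in> Ob C \<Longrightarrow> fob F a \<in> Ob D"
    and far_hom: "f \<in> Hom C a b \<Longrightarrow> far F f \<in> Hom D (fob F a) (fob F b)"
    and far_idn: "a \<in> Ob C \<Longrightarrow> far F (idn C a) = idn D (fob F a)"
    and far_cmp: "\<lbrakk>f \<in> Hom C a b; g \<in> Hom C b c\<rbrakk>
        \<Longrightarrow> far F (g \<cdot>\<^bsub>C\<^esub> f) = far F g \<cdot>\<^bsub>D\<^esub> far F f"

definition natural_iso ::
  "('o, 'm, 'y) cat_scheme \<Rightarrow> ('p, 'n, 'z) cat_scheme \<Rightarrow>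
   ('o, 'm, 'p, 'n) fct \<Rightarrow> ('o, 'm, 'p, 'n) fct \<Rightarrow> ('o \<Rightarrow> 'n) \<Rightarrow> bool" where
  "natural_iso C D F G \<tau> \<longleftrightarrow> cat_functor C D F \<and> cat_functor C D G \<and>
     (\<forall>a \<in> Ob C. \<tau> a \<in> Hom D (fob F a) (fob G a) \<and> iso_arrow D (\<tau> a)) \<and>
     (\<forall>f \<in> Ar C. \<tau> (tgt C f) \<cdot>\<^bsub>D\<^esub> far F f = far G f \<cdot>\<^bsub>D\<^esub> \<tau> (src C f))"

definition cat_equivalence ::
  "('o, 'm, 'y) cat_scheme \<Rightarrow> ('p, 'n, 'z) cat_scheme \<Rightarrow> ('o, 'm, 'p, 'n) fct \<Rightarrow> bool" where
  "cat_equivalence C D F \<longleftrightarrow> cat_functor C D F \<and>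
     (\<exists>G \<eta> \<epsilon>. cat_functor D C G \<and>
        natural_iso C C id_fct (comp_fct G F) \<eta> \<and>
        natural_iso D D (comp_fct F G) id_fct \<epsilon>)"


section \<open>Additive categories\<close>

record ('o, 'm) add_cat = "('o, 'm) cat" +
  add :: "'m \<Rightarrow> 'm \<Rightarrow> 'm"
  zer :: "'o \<Rightarrow> 'o \<Rightarrow> 'm"

definition hom_group :: "('o, 'm, 'z) add_cat_scheme \<Rightarrow> 'o \<Rightarrow> 'o \<Rightarrow> 'm monoid" where
  "hom_group C a b = \<lparr>carrier = Hom C a b, mult = add C, one = zer C a b\<rparr>"

definition neg :: "('o, 'm, 'z) add_cat_scheme \<Rightarrow> 'm \<Rightarrow> 'm" where
  "neg C f = inv\<^bsub>hom_group C (src C f) (tgt C f)\<^esub> f"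

definition zero_object :: "('o, 'm, 'z) cat_scheme \<Rightarrow> 'o \<Rightarrow> bool" where
  "zero_object C z \<longleftrightarrow> z \<in> Ob C \<and>
     (\<forall>a \<in> Ob C. (\<exists>!f. f \<in> Hom C z a) \<and> (\<exists>!f. f \<in> Hom C a z))"

text \<open>\<open>biproduct C a b s\<close>: the object \<open>s\<close> is a direct sum of \<open>a\<close> and \<open>b\<close>.  Direct sums
  are determined only up to isomorphism, hence a predicate.\<close>

definition biproduct :: "('o, 'm, 'z) add_cat_scheme \<Rightarrow> 'o \<Rightarrow> 'o \<Rightarrow> 'o \<Rightarrow> bool" where
  "biproduct C a b s \<longleftrightarrow> a \<in> Ob C \<and> b \<in> Ob C \<and> s \<in> Ob C \<and>
     (\<exists>i \<in> Hom C a s. \<exists>j \<in> Hom C b s. \<exists>p \<in> Hom C s a. \<exists>q \<in> Hom C s b.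
        p \<cdot>\<^bsub>C\<^esub> i = idn C a \<and> q \<cdot>\<^bsub>C\<^esub> j = idn C b \<and>
        q \<cdot>\<^bsub>C\<^esub> i = zer C a b \<and> p \<cdot>\<^bsub>C\<^esub> j = zer C b a \<and>
        add C (i \<cdot>\<^bsub>C\<^esub> p) (j \<cdot>\<^bsub>C\<^esub> q) = idn C s)"

locale additive_category = category C
  for C :: "('o, 'm, 'z) add_cat_scheme" (structure) +
  assumes hom_comm_group: "\<lbrakk>a \<in> Ob C; b \<in> Ob C\<rbrakk> \<Longrightarrow> comm_group (hom_group C a b)"
    and cmp_add_right: "\<lbrakk>f \<in> Hom C a b; f' \<in> Hom C a b; g \<in> Hom C b c\<rbrakk>
        \<Longrightarrow> g \<cdot> add C f f' = add C (g \<cdot> f) (g \<cdot> f')"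
    and cmp_add_left: "\<lbrakk>f \<in> Hom C a b; g \<in> Hom C b c; g' \<in> Hom C b c\<rbrakk>
        \<Longrightarrow> add C g g' \<cdot> f = add C (g \<cdot> f) (g' \<cdot> f)"
    and zero_object_exists: "\<exists>z. zero_object C z"
    and biproduct_exists: "\<lbrakk>a \<in> Ob C; b \<in> Ob C\<rbrakk> \<Longrightarrow> \<exists>s. biproduct C a b s"

definition additive_functor ::
  "('o, 'm, 'y) add_cat_scheme \<Rightarrow> ('p, 'n, 'z) add_cat_scheme \<Rightarrow> ('o, 'm, 'p, 'n) fct \<Rightarrow> bool"
where
  "additive_functor C D F \<longleftrightarrow> cat_functor C D F \<and>
     (\<forall>a \<in> Ob C. \<forall>b \<in> Ob C. \<forall>f \<in> Hom C a b. \<forall>g \<in> Hom C a b.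
        far F (add C f g) = add D (far F f) (far F g))"


section \<open>Triangulated categories\<close>

text \<open>A triangle \<open>a \<rightarrow> b \<rightarrow> c \<rightarrow> \<Sigma>a\<close> is given by its three arrows; \<open>Tri\<close> is the
  class of distinguished triangles and \<open>Sus\<close> is the suspension \<open>\<Sigma>\<close>.\<close>

record ('o, 'm) tri_cat = "('o, 'm) add_cat" +
  Sus :: "('o, 'm, 'o, 'm) fct"
  Tri :: "('m \<times> 'm \<times> 'm) set"

definition triangle :: "('o, 'm, 'z) tri_cat_scheme \<Rightarrow> 'm \<Rightarrow> 'm \<Rightarrow> 'm \<Rightarrow> bool" where
  "triangle C f g h \<longleftrightarrow> f \<in> Ar C \<and> g \<in> Ar C \<and> h \<in> Ar C \<and>
     tgt C f = src C g \<and> tgt C g = src C h \<and> tgt C h = fob (Sus C) (src C f)"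

text \<open>The suspension is required to be an additive self-equivalence, not necessarily an
  automorphism.  The last assumption is the octahedral axiom.\<close>

locale triangulated_category = additive_category C
  for C :: "('o, 'm, 'z) tri_cat_scheme" (structure) +
  assumes Sus_equivalence: "cat_equivalence C C (Sus C)"
    and Sus_additive: "additive_functor C C (Sus C)"
    and Tri_triangle: "(f, g, h) \<in> Tri C \<Longrightarrow> triangle C f g h"
    and Tri_iso_closed:
      "\<lbrakk>(f, g, h) \<in> Tri C; triangle C f' g' h';
        u \<in> Hom C (src C f) (src C f'); v \<in> Hom C (src C g) (src C g');
        w \<in> Hom C (src C h) (src C h');
        iso_arrow C u; iso_arrow C v; iso_arrow C w;
        v \<cdot> f = f' \<cdot> u; w \<cdot> g = g' \<cdot> v; far (Sus C) u \<cdot> h = h' \<cdot> w\<rbrakk>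
       \<Longrightarrow> (f', g', h') \<in> Tri C"
    and Tri_idn: "\<lbrakk>a \<in> Ob C; zero_object C z\<rbrakk>
       \<Longrightarrow> (idn C a, zer C a z, zer C z (fob (Sus C) a)) \<in> Tri C"
    and Tri_cone: "f \<in> Ar C \<Longrightarrow> \<exists>g h. (f, g, h) \<in> Tri C"
    and Tri_rotate: "triangle C f g h
       \<Longrightarrow> (f, g, h) \<in> Tri C \<longleftrightarrow> (g, h, neg C (far (Sus C) f)) \<in> Tri C"
    and Tri_morphism:
      "\<lbrakk>(f, g, h) \<in> Tri C; (f', g', h') \<in> Tri C;
        u \<in> Hom C (src C f) (src C f'); v \<in> Hom C (src C g) (src C g'); v \<cdot> f = f' \<cdot> u\<rbrakk>
       \<Longrightarrow> \<exists>w \<in> Hom C (src C h) (src C h').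
             w \<cdot> g = g' \<cdot> v \<and> far (Sus C) u \<cdot> h = h' \<cdot> w"
    and Tri_octahedral:
      "\<lbrakk>f \<in> Hom C a b; g \<in> Hom C b c;
        (f, f1, f2) \<in> Tri C; (g, g1, g2) \<in> Tri C; (g \<cdot> f, k1, k2) \<in> Tri C\<rbrakk>
       \<Longrightarrow> \<exists>u v. u \<in> Hom C (tgt C f1) (tgt C k1) \<and> v \<in> Hom C (tgt C k1) (tgt C g1) \<and>
             u \<cdot> f1 = k1 \<cdot> g \<and> k2 \<cdot> u = f2 \<and>
             v \<cdot> k1 = g1 \<and> g2 \<cdot> v = far (Sus C) f \<cdot> k2 \<and>
             (u, v, far (Sus C) f1 \<cdot> g2) \<in> Tri C"

definition exact_functor ::
  "('o, 'm, 'y) tri_cat_scheme \<Rightarrow> ('p, 'n, 'z) tri_cat_scheme \<Rightarrow> ('o, 'm, 'p, 'n) fct \<Rightarrow> bool"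
where
  "exact_functor C D F \<longleftrightarrow> additive_functor C D F \<and>
     (\<exists>\<theta>. natural_iso C D (comp_fct F (Sus C)) (comp_fct (Sus D) F) \<theta> \<and>
        (\<forall>f g h. (f, g, h) \<in> Tri C \<longrightarrow>
           (far F f, far F g, \<theta> (src C f) \<cdot>\<^bsub>D\<^esub> far F h) \<in> Tri D))"


section \<open>Symmetric monoidal categories\<close>

record ('o, 'm) monoidal_structure =
  Ten    :: "('o \<times> 'o, 'm \<times> 'm, 'o, 'm) fct"
  Unit   :: 'o
  assocr :: "'o \<Rightarrow> 'o \<Rightarrow> 'o \<Rightarrow> 'm"
  lunit  :: "'o \<Rightarrow> 'm"
  runit  :: "'o \<Rightarrow> 'm"
  braid  :: "'o \<Rightarrow> 'o \<Rightarrow> 'm"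

text \<open>\<open>a \<odot> b\<close> is the tensor product of objects and \<open>f \<star> g\<close> that of arrows.\<close>

locale tensor_data = category C
  for C :: "('o, 'm, 'z) cat_scheme" (structure) +
  fixes M :: "('o, 'm, 'y) monoidal_structure_scheme"
begin

abbreviation ten_ob :: "'o \<Rightarrow> 'o \<Rightarrow> 'o" (infixl "\<odot>" 75) where
  "a \<odot> b \<equiv> fob (Ten M) (a, b)"

abbreviation ten_ar :: "'m \<Rightarrow> 'm \<Rightarrow> 'm" (infixl "\<star>" 75) where
  "f \<star> g \<equiv> far (Ten M) (f, g)"

end

locale symmetric_monoidal_category = tensor_data +
  assumes Ten_functor: "cat_functor (prod_cat C C) C (Ten M)"
    and Unit_closed: "Unit M \<in> Ob C"
    and assocr_natural: "natural_iso (prod_cat C (prod_cat C C)) C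
          \<lparr>fob = (\<lambda>(a, b, c). (a \<odot> b) \<odot> c), far = (\<lambda>(f, g, h). (f \<star> g) \<star> h)\<rparr>
          \<lparr>fob = (\<lambda>(a, b, c). a \<odot> (b \<odot> c)), far = (\<lambda>(f, g, h). f \<star> (g \<star> h))\<rparr>
          (\<lambda>(a, b, c). assocr M a b c)"
    and lunit_natural: "natural_iso C C
          \<lparr>fob = (\<lambda>a. Unit M \<odot> a), far = (\<lambda>f. idn C (Unit M) \<star> f)\<rparr> id_fct (lunit M)"
    and runit_natural: "natural_iso C C
          \<lparr>fob = (\<lambda>a. a \<odot> Unit M), far = (\<lambda>f. f \<star> idn C (Unit M))\<rparr> id_fct (runit M)"
    and braid_natural: "natural_iso (prod_cat C C) C (Ten M)
          \<lparr>fob = (\<lambda>(a, b). b \<odot> a), far = (\<lambda>(f, g). g \<star> f)\<rparr> (\<lambda>(a, b). braid M a b)"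
    and pentagon: "\<lbrakk>a \<in> Ob C; b \<in> Ob C; c \<in> Ob C; d \<in> Ob C\<rbrakk> \<Longrightarrow>
          assocr M a b (c \<odot> d) \<cdot> assocr M (a \<odot> b) c d =
          (idn C a \<star> assocr M b c d) \<cdot> assocr M a (b \<odot> c) d \<cdot> (assocr M a b c \<star> idn C d)"
    and unit_triangle: "\<lbrakk>a \<in> Ob C; b \<in> Ob C\<rbrakk> \<Longrightarrow>
          (idn C a \<star> lunit M b) \<cdot> assocr M a (Unit M) b = runit M a \<star> idn C b"
    and hexagon: "\<lbrakk>a \<in> Ob C; b \<in> Ob C; c \<in> Ob C\<rbrakk> \<Longrightarrow>
          assocr M b c a \<cdot> braid M a (b \<odot> c) \<cdot> assocr M a b c =
          (idn C b \<star> braid M a c) \<cdot> assocr M b a c \<cdot> (braid M a b \<star> idn C c)"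
    and braid_symmetric: "\<lbrakk>a \<in> Ob C; b \<in> Ob C\<rbrakk> \<Longrightarrow>
          braid M b a \<cdot> braid M a b = idn C (a \<odot> b)"


section \<open>Tensor triangulated categories and their radical thick tensor ideals\<close>

text \<open>By symmetry it is enough to require exactness of tensoring on the left.\<close>

locale tensor_triangulated_category =
  triangulated_category C + symmetric_monoidal_category C M
  for C :: "('o, 'm, 'z) tri_cat_scheme" (structure)
    and M :: "('o, 'm, 'y) monoidal_structure_scheme" +
  assumes Ten_exact: "a \<in> Ob C \<Longrightarrow> exact_functor C C
      \<lparr>fob = (\<lambda>b. fob (Ten M) (a, b)), far = (\<lambda>f. far (Ten M) (idn C a, f))\<rparr>"

text \<open>Full subcategories are given by their sets of objects.\<close>

definition triangulated_subcategory :: "('o, 'm, 'z) tri_cat_scheme \<Rightarrow> 'o set \<Rightarrow> bool" where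
  "triangulated_subcategory C I \<longleftrightarrow> I \<subseteq> Ob C \<and>
     (\<exists>z \<in> I. zero_object C z) \<and>
     (\<forall>a \<in> I. \<forall>b \<in> Ob C. iso_objects C a b \<longrightarrow> b \<in> I) \<and>
     (\<forall>a \<in> Ob C. fob (Sus C) a \<in> I \<longleftrightarrow> a \<in> I) \<and>
     (\<forall>f g h. (f, g, h) \<in> Tri C \<and> src C f \<in> I \<and> src C g \<in> I \<longrightarrow> src C h \<in> I)"

definition thick_tensor_ideal ::
  "('o, 'm, 'z) tri_cat_scheme \<Rightarrow> ('o, 'm, 'y) monoidal_structure_scheme \<Rightarrow> 'o set \<Rightarrow> bool"
where
  "thick_tensor_ideal C M I \<longleftrightarrow> triangulated_subcategory C I \<and>
     (\<forall>a b s. biproduct C a b s \<and> a \<in> I \<and> b \<in> I \<longrightarrow> s \<in> I) \<and>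
     (\<forall>a b s. biproduct C a b s \<and> s \<in> I \<longrightarrow> a \<in> I \<and> b \<in> I) \<and>
     (\<forall>a \<in> I. \<forall>b \<in> Ob C. fob (Ten M) (a, b) \<in> I)"

primrec tensor_power :: "('o, 'm, 'y) monoidal_structure_scheme \<Rightarrow> 'o \<Rightarrow> nat \<Rightarrow> 'o" where
  "tensor_power M a 0 = Unit M"
| "tensor_power M a (Suc n) = fob (Ten M) (tensor_power M a n, a)"

definition radical ::
  "('o, 'm, 'z) tri_cat_scheme \<Rightarrow> ('o, 'm, 'y) monoidal_structure_scheme \<Rightarrow> 'o set \<Rightarrow> 'o set"
where
  "radical C M I = {a \<in> Ob C. \<exists>n. tensor_power M a n \<in> I}"

definition radical_thick_tensor_ideal ::
  "('o, 'm, 'z) tri_cat_scheme \<Rightarrow> ('o, 'm, 'y) monoidal_structure_scheme \<Rightarrow> 'o set \<Rightarrow> bool"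
where
  "radical_thick_tensor_ideal C M I \<longleftrightarrow> thick_tensor_ideal C M I \<and> I = radical C M I"

definition generated_ideal ::
  "('o, 'm, 'z) tri_cat_scheme \<Rightarrow> ('o, 'm, 'y) monoidal_structure_scheme \<Rightarrow> 'o set \<Rightarrow> 'o set"
where
  "generated_ideal C M S = \<Inter> {I. thick_tensor_ideal C M I \<and> S \<subseteq> I}"

definition principal_radical ::
  "('o, 'm, 'z) tri_cat_scheme \<Rightarrow> ('o, 'm, 'y) monoidal_structure_scheme \<Rightarrow> 'o \<Rightarrow> 'o set"
where
  "principal_radical C M a = radical C M (generated_ideal C M {a})"

text \<open>Since \<open>Ob C\<close> is a set, the radical thick tensor ideals automatically form a set.\<close>

definition radical_ideal_order ::
  "('o, 'm, 'z) tri_cat_scheme \<Rightarrow> ('o, 'm, 'y) monoidal_structure_scheme \<Rightarrow> 'o set gorder"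
where
  "radical_ideal_order C M =
     \<lparr>carrier = {I. radical_thick_tensor_ideal C M I}, eq = (=), le = (\<subseteq>)\<rparr>"


section \<open>Coherent frames\<close>

locale frame = complete_lattice L for L (structure) +
  assumes meet_Sup_distrib: "\<lbrakk>x \<in> carrier L; A \<subseteq> carrier L\<rbrakk>
      \<Longrightarrow> x \<sqinter> \<Squnion>A = \<Squnion>((\<lambda>a. x \<sqinter> a) ` A)"

definition finite_elements :: "('a, 'z) gorder_scheme \<Rightarrow> 'a set" where
  "finite_elements L = {c \<in> carrier L. \<forall>S \<subseteq> carrier L. c \<sqsubseteq>\<^bsub>L\<^esub> \<Squnion>\<^bsub>L\<^esub>S \<longrightarrow>
     (\<exists>K \<subseteq> S. finite K \<and> c \<sqsubseteq>\<^bsub>L\<^esub> \<Squnion>\<^bsub>L\<^esub>K)}"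

locale coherent_frame = frame L for L (structure) +
  assumes join_of_finite_elements: "x \<in> carrier L \<Longrightarrow> \<exists>A \<subseteq> finite_elements L. x = \<Squnion>A"
    and finite_bottom: "\<bottom> \<in> finite_elements L"
    and finite_top: "\<top> \<in> finite_elements L"
    and finite_join: "\<lbrakk>x \<in> finite_elements L; y \<in> finite_elements L\<rbrakk> \<Longrightarrow> x \<squnion> y \<in> finite_elements L"
    and finite_meet: "\<lbrakk>x \<in> finite_elements L; y \<in> finite_elements L\<rbrakk> \<Longrightarrow> x \<sqinter> y \<in> finite_elements L"

end

theory Submission
  imports Defs
begin

text \<open>Everything rests on the colon ideals \<open>(I : x) = {y. x \<otimes> y \<in> I}\<close>, which are thick
  tensor ideals because tensoring with \<open>x\<close> is exact, and are radical whenever \<open>I\<close> is.  They show that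
  the radical of a thick tensor ideal is again a thick tensor ideal, that \<open>\<surd>a \<inter> \<surd>b = \<surd>(a \<otimes> b)\<close>,
  and that binary meets distribute over arbitrary joins.  Compactness of \<open>\<surd>a\<close> is finitary: a directed
  union of radical thick tensor ideals is one, so membership in a join involves only finitely many of
  the joined ideals.  Finite joins of principal ideals are principal by taking direct sums.\<close>

section \<open>Isomorphic objects\<close>

lemma HomD:
  assumes "f \<in> Hom C a b"
  shows "f \<in> Ar C" "src C f = a" "tgt C f = b"
  using assms by (auto simp: Hom_def)

text \<open>Spells the inverse out between named objects, so later proofs need not mention
  \<open>src\<close> and \<open>tgt\<close>.\<close>

lemma iso_objects_alt:
  "iso_objects C a b \<longleftrightarrow>
    (\<exists>f \<in> Hom C a b. \<exists>g \<in> Hom C b a. g \<cdot>\<^bsub>C\<^esub> f = idn C a \<and> f \<cdot>\<^bsub>C\<^esub> g = idn C b)"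
  unfolding iso_objects_def iso_arrow_def by (auto simp: Hom_def)

lemma iso_objects_sym: "iso_objects C a b \<Longrightarrow> iso_objects C b a"
  unfolding iso_objects_alt by blast

lemma (in category) iso_objects_refl: "a \<in> Ob C \<Longrightarrow> iso_objects C a a"
  unfolding iso_objects_alt using idn_hom cmp_idn_left by blast

lemma (in category) iso_objects_trans:
  assumes "iso_objects C a b" "iso_objects C b c"
  shows "iso_objects C a c"
proof -
  obtain f f' where f: "f \<in> Hom C a b" "f' \<in> Hom C b a" "f' \<cdot> f = idn C a" "f \<cdot> f' = idn C b"
    using assms(1) unfolding iso_objects_alt by blast
  obtain g g' where g: "g \<in> Hom C b c" "g' \<in> Hom C c b" "g' \<cdot> g = idn C b" "g \<cdot> g' = idn C c"
    using assms(2) unfolding iso_objects_alt by blast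
  have gf: "g \<cdot> f \<in> Hom C a c" and gf': "f' \<cdot> g' \<in> Hom C c a"
    using f g cmp_hom by blast+
  have "g' \<cdot> (g \<cdot> f) = f"
    using cmp_assoc[OF f(1) g(1,2)] cmp_idn_left[OF f(1)] g(3) by simp
  then have 1: "(f' \<cdot> g') \<cdot> (g \<cdot> f) = idn C a"
    using cmp_assoc[OF gf g(2) f(2)] f(3) by simp
  have "f \<cdot> (f' \<cdot> g') = g'"
    using cmp_assoc[OF g(2) f(2,1)] cmp_idn_left[OF g(2)] f(4) by simp
  then have 2: "(g \<cdot> f) \<cdot> (f' \<cdot> g') = idn C c"
    using cmp_assoc[OF gf' f(1) g(1)] g(4) by simp
  show ?thesis
    unfolding iso_objects_alt using gf gf' 1 2 by blast
qed

lemma (in cat_functor) iso_objects_fob: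
  assumes "iso_objects C a b" "a \<in> Ob C" "b \<in> Ob C"
  shows "iso_objects D (fob F a) (fob F b)"
proof -
  obtain f g where f: "f \<in> Hom C a b" and g: "g \<in> Hom C b a"
    and gf: "g \<cdot>\<^bsub>C\<^esub> f = idn C a" and fg: "f \<cdot>\<^bsub>C\<^esub> g = idn C b"
    using assms unfolding iso_objects_alt by blast
  have "far F g \<cdot>\<^bsub>D\<^esub> far F f = idn D (fob F a)"
    using far_cmp[OF f g] far_idn assms(2) gf by simp
  moreover have "far F f \<cdot>\<^bsub>D\<^esub> far F g = idn D (fob F b)"
    using far_cmp[OF g f] far_idn assms(3) fg by simp
  ultimately show ?thesis
    unfolding iso_objects_alt using far_hom[OF f] far_hom[OF g] by blast
qed

lemma natural_iso_objects:
  "natural_iso C D F G \<tau> \<Longrightarrow> a \<in> Ob C \<Longrightarrow> iso_objects D (fob F a) (fob G a)"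
  unfolding natural_iso_def iso_objects_def by blast

lemma Ob_prod_cat: "Ob (prod_cat C D) = Ob C \<times> Ob D"
  by (simp add: prod_cat_def)

text \<open>Since \<open>Ten M\<close> is a functor on a product category, this is what lets both
  tensor factors be replaced by isomorphic objects at once.\<close>

lemma iso_objects_prod_cat:
  assumes "iso_objects C a a'" "iso_objects D b b'"
  shows "iso_objects (prod_cat C D) (a, b) (a', b')"
proof -
  obtain f f' where "f \<in> Hom C a a'" "f' \<in> Hom C a' a"
    "f' \<cdot>\<^bsub>C\<^esub> f = idn C a" "f \<cdot>\<^bsub>C\<^esub> f' = idn C a'"
    using assms(1) unfolding iso_objects_alt by blast
  moreover obtain g g' where "g \<in> Hom D b b'" "g' \<in> Hom D b' b"
    "g' \<cdot>\<^bsub>D\<^esub> g = idn D b" "g \<cdot>\<^bsub>D\<^esub> g' = idn D b'"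
    using assms(2) unfolding iso_objects_alt by blast
  ultimately have "(f, g) \<in> Hom (prod_cat C D) (a, b) (a', b')"
    "(f', g') \<in> Hom (prod_cat C D) (a', b') (a, b)"
    "(f', g') \<cdot>\<^bsub>prod_cat C D\<^esub> (f, g) = idn (prod_cat C D) (a, b)"
    "(f, g) \<cdot>\<^bsub>prod_cat C D\<^esub> (f', g') = idn (prod_cat C D) (a', b')"
    by (simp_all add: Hom_def prod_cat_def)
  then show ?thesis
    unfolding iso_objects_alt by blast
qed

section \<open>Additive functors and direct sums\<close>

text \<open>In a group the neutral element is the only idempotent, so cancellation suffices.\<close>

lemma (in additive_category) zer_eqI:
  assumes "a \<in> Ob C" "b \<in> Ob C" "f \<in> Hom C a b" "add C f f = f"
  shows "f = zer C a b"
proof -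
  interpret comm_group "hom_group C a b"
    using hom_comm_group assms(1,2) .
  show ?thesis
    using assms(3,4) l_cancel_one[of f f] by (simp add: hom_group_def)
qed

lemma (in additive_category) zer_hom:
  assumes "a \<in> Ob C" "b \<in> Ob C"
  shows "zer C a b \<in> Hom C a b" "add C (zer C a b) (zer C a b) = zer C a b"
proof -
  interpret comm_group "hom_group C a b"
    using hom_comm_group assms .
  show "zer C a b \<in> Hom C a b" "add C (zer C a b) (zer C a b) = zer C a b"
    using one_closed l_one[OF one_closed] by (simp_all add: hom_group_def)
qed

text \<open>A direct sum is given by equations between composites, sums, identities and zero arrows,
  all of which an additive functor preserves. It is applied to tensoring with a fixed
  object.\<close>

lemma additive_functor_biproduct:
  assumes "additive_category C" "additive_category D"
    and F: "additive_functor C D F" and "biproduct C a b s"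
  shows "biproduct D (fob F a) (fob F b) (fob F s)"
proof -
  interpret C: additive_category C by fact
  interpret D: additive_category D by fact
  interpret F: cat_functor C D F
    using F by (simp add: additive_functor_def)
  have ob: "a \<in> Ob C" "b \<in> Ob C" "s \<in> Ob C"
    using assms(4) by (auto simp: biproduct_def)
  obtain i j p q where h: "i \<in> Hom C a s" "j \<in> Hom C b s" "p \<in> Hom C s a" "q \<in> Hom C s b"
    and e: "p \<cdot>\<^bsub>C\<^esub> i = idn C a" "q \<cdot>\<^bsub>C\<^esub> j = idn C b"
      "q \<cdot>\<^bsub>C\<^esub> i = zer C a b" "p \<cdot>\<^bsub>C\<^esub> j = zer C b a"
      "add C (i \<cdot>\<^bsub>C\<^esub> p) (j \<cdot>\<^bsub>C\<^esub> q) = idn C s"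
    using assms(4) unfolding biproduct_def by blast
  have add: "far F (add C f g) = add D (far F f) (far F g)"
    if "f \<in> Hom C x y" "g \<in> Hom C x y" "x \<in> Ob C" "y \<in> Ob C" for f g x y
    using F that unfolding additive_functor_def by blast
  \<comment> \<open>Preservation of zero arrows is derived: the image of an idempotent for addition
    is again idempotent.\<close>
  have zer: "far F (zer C x y) = zer D (fob F x) (fob F y)" if "x \<in> Ob C" "y \<in> Ob C" for x y
    using D.zer_eqI[OF F.fob_closed[OF that(1)] F.fob_closed[OF that(2)] F.far_hom[OF C.zer_hom(1)[OF that]]]
      add[OF C.zer_hom(1)[OF that] C.zer_hom(1)[OF that] that, symmetric] C.zer_hom(2)[OF that] by simp
  have Fh: "far F i \<in> Hom D (fob F a) (fob F s)" "far F j \<in> Hom D (fob F b) (fob F s)"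
    "far F p \<in> Hom D (fob F s) (fob F a)" "far F q \<in> Hom D (fob F s) (fob F b)"
    using h F.far_hom by blast+
  have 1: "far F p \<cdot>\<^bsub>D\<^esub> far F i = idn D (fob F a)" "far F q \<cdot>\<^bsub>D\<^esub> far F j = idn D (fob F b)"
    "far F q \<cdot>\<^bsub>D\<^esub> far F i = zer D (fob F a) (fob F b)"
    "far F p \<cdot>\<^bsub>D\<^esub> far F j = zer D (fob F b) (fob F a)"
    using F.far_cmp[OF h(1,3)] F.far_cmp[OF h(2,4)] F.far_cmp[OF h(1,4)] F.far_cmp[OF h(2,3)]
      e ob F.far_idn zer by simp_all
  have "i \<cdot>\<^bsub>C\<^esub> p \<in> Hom C s s" "j \<cdot>\<^bsub>C\<^esub> q \<in> Hom C s s"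
    using h C.cmp_hom by blast+
  then have "far F (add C (i \<cdot>\<^bsub>C\<^esub> p) (j \<cdot>\<^bsub>C\<^esub> q)) = add D (far F (i \<cdot>\<^bsub>C\<^esub> p)) (far F (j \<cdot>\<^bsub>C\<^esub> q))"
    using add ob by blast
  then have 2: "add D (far F i \<cdot>\<^bsub>D\<^esub> far F p) (far F j \<cdot>\<^bsub>D\<^esub> far F q) = idn D (fob F s)"
    by (simp only: e(5) F.far_idn[OF ob(3)] F.far_cmp[OF h(3,1)] F.far_cmp[OF h(4,2)])
  show ?thesis
    unfolding biproduct_def
    by (intro conjI bexI[OF _ Fh(1)] bexI[OF _ Fh(2)] bexI[OF _ Fh(3)] bexI[OF _ Fh(4)]
        F.fob_closed ob 1 2)
qed

section \<open>The commutative monoid of isomorphism classes\<close>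

context tensor_triangulated_category
begin

abbreviation iso (infix "\<simeq>" 50) where
  "a \<simeq> b \<equiv> iso_objects C a b"

lemma ten_closed [simp]: "a \<in> Ob C \<Longrightarrow> b \<in> Ob C \<Longrightarrow> a \<odot> b \<in> Ob C"
  using cat_functor.fob_closed[OF Ten_functor, of "(a, b)"] by (simp add: Ob_prod_cat)

declare Unit_closed [simp]

lemma tensor_power_closed [simp]: "a \<in> Ob C \<Longrightarrow> tensor_power M a n \<in> Ob C"
  by (induction n) simp_all

lemma ten_iso_cong:
  assumes "a \<simeq> a'" "b \<simeq> b'" "a \<in> Ob C" "a' \<in> Ob C" "b \<in> Ob C" "b' \<in> Ob C"
  shows "a \<odot> b \<simeq> a' \<odot> b'"
  using cat_functor.iso_objects_fob[OF Ten_functor iso_objects_prod_cat[OF assms(1,2)]] assms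
  by (simp add: Ob_prod_cat)

lemma ten_assoc_iso: "a \<in> Ob C \<Longrightarrow> b \<in> Ob C \<Longrightarrow> c \<in> Ob C \<Longrightarrow> (a \<odot> b) \<odot> c \<simeq> a \<odot> (b \<odot> c)"
  using natural_iso_objects[OF assocr_natural, of "(a, b, c)"] by (simp add: Ob_prod_cat)

lemma ten_comm_iso: "a \<in> Ob C \<Longrightarrow> b \<in> Ob C \<Longrightarrow> a \<odot> b \<simeq> b \<odot> a"
  using natural_iso_objects[OF braid_natural, of "(a, b)"] by (simp add: Ob_prod_cat)

lemma ten_unit_iso: "a \<in> Ob C \<Longrightarrow> Unit M \<odot> a \<simeq> a"
  using natural_iso_objects[OF lunit_natural, of a] by (simp add: id_fct_def)

definition iso_class :: "'o \<Rightarrow> 'o set" where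
  "iso_class a = {b \<in> Ob C. a \<simeq> b}"

text \<open>Passing to isomorphism classes turns rearrangements of tensor factors into equations.
  The product uses arbitrarily chosen representatives; \<open>iso_class_ten\<close> shows that the
  choice does not matter.\<close>

definition class_monoid :: "'o set monoid" where
  "class_monoid = \<lparr>carrier = iso_class ` Ob C,
     mult = (\<lambda>A B. iso_class ((SOME a. a \<in> A) \<odot> (SOME b. b \<in> B))), one = iso_class (Unit M)\<rparr>"

lemma iso_class_eq_iff:
  assumes "a \<in> Ob C" "b \<in> Ob C"
  shows "iso_class a = iso_class b \<longleftrightarrow> a \<simeq> b"
proof
  assume "iso_class a = iso_class b"
  moreover have "b \<in> iso_class b"
    using assms iso_objects_refl by (simp add: iso_class_def)
  ultimately show "a \<simeq> b"
    unfolding iso_class_def by blast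
next
  assume "a \<simeq> b"
  then have "a \<simeq> c \<longleftrightarrow> b \<simeq> c" for c
    using iso_objects_trans iso_objects_sym by metis
  then show "iso_class a = iso_class b"
    by (simp add: iso_class_def)
qed

lemma carrier_class_monoid: "carrier class_monoid = iso_class ` Ob C"
  by (simp add: class_monoid_def)

lemma iso_class_closed [simp]: "a \<in> Ob C \<Longrightarrow> iso_class a \<in> carrier class_monoid"
  by (simp add: carrier_class_monoid)

lemma iso_class_ten [simp]:
  assumes "a \<in> Ob C" "b \<in> Ob C"
  shows "iso_class (a \<odot> b) = iso_class a \<otimes>\<^bsub>class_monoid\<^esub> iso_class b"
proof -
  have rep: "(SOME y. y \<in> iso_class x) \<in> Ob C \<and> x \<simeq> (SOME y. y \<in> iso_class x)"
    if "x \<in> Ob C" for x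
    using someI[of "\<lambda>y. y \<in> iso_class x" x] that iso_objects_refl by (simp add: iso_class_def)
  then have "a \<odot> b \<simeq> (SOME y. y \<in> iso_class a) \<odot> (SOME y. y \<in> iso_class b)"
    using assms by (intro ten_iso_cong) blast+
  then show ?thesis
    using rep assms by (simp add: class_monoid_def iso_class_eq_iff)
qed

lemma iso_class_Unit [simp]: "iso_class (Unit M) = \<one>\<^bsub>class_monoid\<^esub>"
  by (simp add: class_monoid_def)

lemma iso_class_eqI: "a \<simeq> b \<Longrightarrow> a \<in> Ob C \<Longrightarrow> b \<in> Ob C \<Longrightarrow> iso_class a = iso_class b"
  by (simp add: iso_class_eq_iff)

text \<open>Associator, braiding and left unitor become the monoid laws. From here on, reordering
  tensor factors is rewriting modulo associativity and commutativity.\<close>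

lemma comm_monoid_class_monoid: "comm_monoid class_monoid"
proof (rule comm_monoidI)
  fix x y z
  assume "x \<in> carrier class_monoid" "y \<in> carrier class_monoid" "z \<in> carrier class_monoid"
  then obtain a b c where "a \<in> Ob C" "b \<in> Ob C" "c \<in> Ob C"
    "x = iso_class a" "y = iso_class b" "z = iso_class c"
    unfolding carrier_class_monoid by blast
  then show "(x \<otimes>\<^bsub>class_monoid\<^esub> y) \<otimes>\<^bsub>class_monoid\<^esub> z = x \<otimes>\<^bsub>class_monoid\<^esub> (y \<otimes>\<^bsub>class_monoid\<^esub> z)"
    using iso_class_eqI[OF ten_assoc_iso, of a b c] by simp
next
  fix x y
  assume "x \<in> carrier class_monoid" "y \<in> carrier class_monoid"
  then obtain a b where ab: "a \<in> Ob C" "b \<in> Ob C" "x = iso_class a" "y = iso_class b"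
    unfolding carrier_class_monoid by blast
  then show "x \<otimes>\<^bsub>class_monoid\<^esub> y \<in> carrier class_monoid"
    using iso_class_closed[OF ten_closed, of a b] by simp
  show "x \<otimes>\<^bsub>class_monoid\<^esub> y = y \<otimes>\<^bsub>class_monoid\<^esub> x"
    using ab iso_class_eqI[OF ten_comm_iso, of a b] by simp
next
  fix x
  assume "x \<in> carrier class_monoid"
  then obtain a where "a \<in> Ob C" "x = iso_class a"
    unfolding carrier_class_monoid by blast
  then show "\<one>\<^bsub>class_monoid\<^esub> \<otimes>\<^bsub>class_monoid\<^esub> x = x"
    using iso_class_eqI[OF ten_unit_iso, of a] by simp
next
  show "\<one>\<^bsub>class_monoid\<^esub> \<in> carrier class_monoid"
    using iso_class_closed[OF Unit_closed] by simp
qed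

sublocale iso: comm_monoid class_monoid
  by (rule comm_monoid_class_monoid)

text \<open>Both recursions start at the unit and multiply by the base on the right, so the power
  laws of commutative monoids carry over to tensor powers.\<close>

lemma iso_class_tensor_power [simp]:
  "a \<in> Ob C \<Longrightarrow> iso_class (tensor_power M a n) = iso_class a [^]\<^bsub>class_monoid\<^esub> n"
  by (induction n) simp_all

section \<open>Thick tensor ideals\<close>

lemma ideal_subset: "thick_tensor_ideal C M I \<Longrightarrow> a \<in> I \<Longrightarrow> a \<in> Ob C"
  unfolding thick_tensor_ideal_def triangulated_subcategory_def by blast

lemma ideal_iso:
  "thick_tensor_ideal C M I \<Longrightarrow> a \<in> I \<Longrightarrow> a \<simeq> b \<Longrightarrow> b \<in> Ob C \<Longrightarrow> b \<in> I"
  unfolding thick_tensor_ideal_def triangulated_subcategory_def by blast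

text \<open>The working form of closure under isomorphism: the side condition is an equation in
  \<open>class_monoid\<close>, left to the simplifier.\<close>

lemma ideal_iso_class:
  assumes "thick_tensor_ideal C M I" "a \<in> I" "iso_class a = iso_class b" "b \<in> Ob C"
  shows "b \<in> I"
  using ideal_iso[OF assms(1,2)] iso_class_eq_iff[OF ideal_subset[OF assms(1,2)] assms(4)] assms
  by blast

lemma ideal_suspension:
  "thick_tensor_ideal C M I \<Longrightarrow> a \<in> Ob C \<Longrightarrow> fob (Sus C) a \<in> I \<longleftrightarrow> a \<in> I"
  unfolding thick_tensor_ideal_def triangulated_subcategory_def by blast

lemma ideal_cone:
  "thick_tensor_ideal C M I \<Longrightarrow> (f, g, h) \<in> Tri C \<Longrightarrow> src C f \<in> I \<Longrightarrow> src C g \<in> I \<Longrightarrow> src C h \<in> I"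
  unfolding thick_tensor_ideal_def triangulated_subcategory_def by blast

lemma ideal_sum: "thick_tensor_ideal C M I \<Longrightarrow> biproduct C a b s \<Longrightarrow> s \<in> I \<longleftrightarrow> a \<in> I \<and> b \<in> I"
  unfolding thick_tensor_ideal_def by blast

lemma ideal_ten_right: "thick_tensor_ideal C M I \<Longrightarrow> a \<in> I \<Longrightarrow> b \<in> Ob C \<Longrightarrow> a \<odot> b \<in> I"
  unfolding thick_tensor_ideal_def by blast

lemma ideal_ten_left: "thick_tensor_ideal C M I \<Longrightarrow> a \<in> I \<Longrightarrow> b \<in> Ob C \<Longrightarrow> b \<odot> a \<in> I"
  by (rule ideal_iso[OF _ ideal_ten_right ten_comm_iso]) (auto dest: ideal_subset)

lemma zero_object_iso:
  assumes z: "zero_object C z" and w: "zero_object C w"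
  shows "z \<simeq> w"
proof -
  have ob: "z \<in> Ob C" "w \<in> Ob C"
    using assms by (simp_all add: zero_object_def)
  have hom: "\<exists>!f. f \<in> Hom C z w" "\<exists>!f. f \<in> Hom C w z" "\<exists>!f. f \<in> Hom C z z" "\<exists>!f. f \<in> Hom C w w"
    using z w ob by (simp_all add: zero_object_def)
  obtain f g where f: "f \<in> Hom C z w" and g: "g \<in> Hom C w z"
    using hom(1,2)[THEN ex1_implies_ex] by (elim exE)
  have "g \<cdot> f = idn C z"
    using hom(3) cmp_hom[OF f g] idn_hom[OF ob(1)] by metis
  moreover have "f \<cdot> g = idn C w"
    using hom(4) cmp_hom[OF g f] idn_hom[OF ob(2)] by metis
  ultimately show ?thesis
    unfolding iso_objects_alt using f g by (intro bexI conjI)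
qed

text \<open>The definition only provides some zero object; uniqueness up to isomorphism provides all
  of them.\<close>

lemma ideal_zero_object:
  assumes "thick_tensor_ideal C M I" "zero_object C z"
  shows "z \<in> I"
proof -
  obtain w where w: "w \<in> I" "zero_object C w"
    using assms(1) unfolding thick_tensor_ideal_def triangulated_subcategory_def by blast
  moreover have "z \<in> Ob C"
    using assms(2) by (simp add: zero_object_def)
  ultimately show ?thesis
    using ideal_iso[OF assms(1) w(1)] zero_object_iso[OF w(2) assms(2)] by blast
qed

text \<open>The largest ideal. It keeps the family intersected in \<open>generated_ideal\<close>
  nonempty and later becomes the top element.\<close>

lemma thick_tensor_ideal_Ob: "thick_tensor_ideal C M (Ob C)"
  unfolding thick_tensor_ideal_def triangulated_subcategory_def
proof (intro conjI allI ballI impI)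
  interpret Sus: cat_functor C C "Sus C"
    using Sus_additive by (simp add: additive_functor_def)
  show "\<exists>z \<in> Ob C. zero_object C z"
    using zero_object_exists by (auto simp: zero_object_def)
  show "fob (Sus C) a \<in> Ob C \<longleftrightarrow> a \<in> Ob C" if "a \<in> Ob C" for a
    using that Sus.fob_closed by blast
next
  fix f g h assume "(f, g, h) \<in> Tri C \<and> src C f \<in> Ob C \<and> src C g \<in> Ob C"
  then show "src C h \<in> Ob C"
    using Tri_triangle src_closed unfolding triangle_def by blast
qed (auto simp: biproduct_def)

text \<open>Every closure condition on a thick tensor ideal involves at most two members, so it
  can be checked one pair at a time.\<close>

lemma thick_tensor_idealI:
  assumes sub: "I \<subseteq> Ob C" and ne: "I \<noteq> {}"
    and pair: "\<And>a b c. \<lbrakk>a \<in> I; b \<in> I;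
      \<And>J. thick_tensor_ideal C M J \<Longrightarrow> a \<in> J \<Longrightarrow> b \<in> J \<Longrightarrow> c \<in> J\<rbrakk> \<Longrightarrow> c \<in> I"
  shows "thick_tensor_ideal C M I"
  unfolding thick_tensor_ideal_def triangulated_subcategory_def
proof (intro conjI allI ballI impI)
  show "I \<subseteq> Ob C" by fact
  obtain a z where "a \<in> I" "zero_object C z"
    using ne zero_object_exists by blast
  then show "\<exists>z \<in> I. zero_object C z"
    using pair[of a a z] ideal_zero_object by blast
next
  fix a b assume "a \<in> I" "b \<in> Ob C" "a \<simeq> b"
  then show "b \<in> I"
    using pair[of a a b] ideal_iso by blast
next
  fix a assume "a \<in> Ob C"
  then show "fob (Sus C) a \<in> I \<longleftrightarrow> a \<in> I"
    using pair[of a a "fob (Sus C) a"] pair[of "fob (Sus C) a" "fob (Sus C) a" a]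
      ideal_suspension by blast
next
  fix f g h assume "(f, g, h) \<in> Tri C \<and> src C f \<in> I \<and> src C g \<in> I"
  then show "src C h \<in> I"
    using pair[of "src C f" "src C g" "src C h"] ideal_cone by blast
next
  fix a b s assume "biproduct C a b s \<and> a \<in> I \<and> b \<in> I"
  then show "s \<in> I"
    using pair[of a b s] ideal_sum by blast
next
  fix a b s assume "biproduct C a b s \<and> s \<in> I"
  then show "a \<in> I" "b \<in> I"
    using pair[of s s a] pair[of s s b] ideal_sum by blast+
next
  fix a b assume "a \<in> I" "b \<in> Ob C"
  then show "a \<odot> b \<in> I"
    using pair[of a a "a \<odot> b"] ideal_ten_right by blast
qed

text \<open>Each member of the family is one of the ideals \<open>J\<close> over which the pair
  criterion quantifies. Nonemptiness of the family keeps the intersection inside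
  \<open>Ob C\<close>.\<close>

lemma thick_tensor_ideal_Inter:
  assumes "\<I> \<noteq> {}" "\<And>I. I \<in> \<I> \<Longrightarrow> thick_tensor_ideal C M I"
  shows "thick_tensor_ideal C M (\<Inter>\<I>)"
proof (rule thick_tensor_idealI)
  show "\<Inter>\<I> \<subseteq> Ob C"
    using assms ideal_subset by blast
  show "\<Inter>\<I> \<noteq> {}"
    using assms(2) zero_object_exists ideal_zero_object by blast
qed (use assms in blast)

lemma
  assumes "S \<subseteq> Ob C"
  shows thick_generated_ideal: "thick_tensor_ideal C M (generated_ideal C M S)"
    and subset_generated_ideal: "S \<subseteq> generated_ideal C M S"
  unfolding generated_ideal_def
  using thick_tensor_ideal_Ob assms by (auto intro!: thick_tensor_ideal_Inter)

lemma generated_ideal_least: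
  "thick_tensor_ideal C M J \<Longrightarrow> S \<subseteq> J \<Longrightarrow> generated_ideal C M S \<subseteq> J"
  unfolding generated_ideal_def by blast

section \<open>Colon ideals\<close>

definition colon :: "'o set \<Rightarrow> 'o \<Rightarrow> 'o set" where
  "colon I x = {y \<in> Ob C. x \<odot> y \<in> I}"

text \<open>The colon ideal is the preimage of \<open>I\<close> under the exact functor
  \<open>F\<close> of tensoring with \<open>x\<close>. Additivity of \<open>F\<close> handles direct
  sums, \<open>\<theta>\<close> handles suspensions and cones, and the associator handles tensor
  products.\<close>

lemma thick_tensor_ideal_colon:
  assumes I: "thick_tensor_ideal C M I" and x: "x \<in> Ob C"
  shows "thick_tensor_ideal C M (colon I x)"
proof -
  define F where "F = \<lparr>fob = (\<lambda>b. x \<odot> b), far = (\<lambda>f. idn C x \<star> f)\<rparr>"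
  have F_fob: "fob F y = x \<odot> y" for y
    by (simp add: F_def)
  have "exact_functor C C F"
    using Ten_exact[OF x] by (simp add: F_def)
  then obtain \<theta> where add: "additive_functor C C F"
    and nat: "natural_iso C C (comp_fct F (Sus C)) (comp_fct (Sus C) F) \<theta>"
    and tri: "\<And>f g h. (f, g, h) \<in> Tri C \<Longrightarrow> (far F f, far F g, \<theta> (src C f) \<cdot> far F h) \<in> Tri C"
    unfolding exact_functor_def by blast
  interpret F: cat_functor C C F
    using add by (simp add: additive_functor_def)
  interpret Sus: cat_functor C C "Sus C"
    using Sus_additive by (simp add: additive_functor_def)
  have ob: "colon I x \<subseteq> Ob C"
    by (auto simp: colon_def)
  have "\<exists>z \<in> colon I x. zero_object C z"
  proof -
    obtain z where "zero_object C z"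
      using zero_object_exists by blast
    then show ?thesis
      using ideal_ten_left[OF I ideal_zero_object[OF I] x]
      by (auto simp: colon_def zero_object_def)
  qed
  moreover have "b \<in> colon I x" if "a \<in> colon I x" "b \<in> Ob C" "a \<simeq> b" for a b
    using that F.iso_objects_fob[OF that(3)] ideal_iso[OF I] x by (auto simp: colon_def F_fob)
  moreover have "fob (Sus C) a \<in> colon I x \<longleftrightarrow> a \<in> colon I x" if "a \<in> Ob C" for a
  proof -
    have "x \<odot> fob (Sus C) a \<simeq> fob (Sus C) (x \<odot> a)"
      using natural_iso_objects[OF nat that] by (simp add: comp_fct_def F_fob)
    then have "x \<odot> fob (Sus C) a \<in> I \<longleftrightarrow> fob (Sus C) (x \<odot> a) \<in> I"
      using ideal_iso[OF I] iso_objects_sym x that Sus.fob_closed ten_closed by metis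
    then show ?thesis
      using that x ideal_suspension[OF I] Sus.fob_closed by (simp add: colon_def)
  qed
  moreover have "src C h \<in> colon I x"
    if t: "(f, g, h) \<in> Tri C" and f: "src C f \<in> colon I x" and g: "src C g \<in> colon I x" for f g h
  proof -
    have ar: "f \<in> Ar C" "g \<in> Ar C" "h \<in> Ar C" and tgt_h: "tgt C h = fob (Sus C) (src C f)"
      using Tri_triangle[OF t] by (auto simp: triangle_def)
    have src: "far F k \<in> Hom C (x \<odot> src C k) (x \<odot> tgt C k)" if "k \<in> Ar C" for k
      using F.far_hom[of k "src C k" "tgt C k"] that by (simp add: Hom_def F_fob)
    \<comment> \<open>The last arrow of the image triangle is corrected by \<open>\<theta>\<close>.
      Its typing is needed only to see that its source is still \<open>x \<odot> src C h\<close>,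
      the object to which \<open>ideal_cone\<close> applies.\<close>
    have "\<theta> (src C f) \<in> Hom C (x \<odot> fob (Sus C) (src C f)) (fob (Sus C) (x \<odot> src C f))"
      using nat src_closed[OF ar(1)] by (simp add: natural_iso_def comp_fct_def F_fob)
    then have "\<theta> (src C f) \<cdot> far F h \<in> Hom C (x \<odot> src C h) (fob (Sus C) (x \<odot> src C f))"
      using cmp_hom src[OF ar(3)] tgt_h by metis
    then have "x \<odot> src C h \<in> I"
      using ideal_cone[OF I tri[OF t]] f g HomD(2)[OF src[OF ar(1)]] HomD(2)[OF src[OF ar(2)]]
      by (simp add: colon_def HomD(2))
    then show ?thesis
      using src_closed[OF ar(3)] by (simp add: colon_def)
  qed
  moreover have "s \<in> colon I x \<longleftrightarrow> a \<in> colon I x \<and> b \<in> colon I x" if "biproduct C a b s" for a b s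
  proof -
    have "biproduct C (x \<odot> a) (x \<odot> b) (x \<odot> s)"
      using additive_functor_biproduct[OF additive_category_axioms additive_category_axioms add that]
      by (simp add: F_fob)
    moreover have "a \<in> Ob C" "b \<in> Ob C" "s \<in> Ob C"
      using that by (auto simp: biproduct_def)
    ultimately show ?thesis
      using ideal_sum[OF I] by (simp add: colon_def)
  qed
  moreover have "a \<odot> b \<in> colon I x" if "a \<in> colon I x" "b \<in> Ob C" for a b
  proof -
    have a: "a \<in> Ob C" "x \<odot> a \<in> I"
      using that by (auto simp: colon_def)
    then have "x \<odot> (a \<odot> b) \<in> I"
      using ideal_iso[OF I ideal_ten_right[OF I a(2) that(2)] ten_assoc_iso[OF x a(1) that(2)]] x that
      by simp
    then show ?thesis
      using a that by (simp add: colon_def)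
  qed
  ultimately show ?thesis
    unfolding thick_tensor_ideal_def triangulated_subcategory_def using ob by blast
qed

section \<open>Radicals\<close>

text \<open>The induction replaces \<open>x\<close> by \<open>x \<odot> a\<close> and by \<open>x \<odot> b\<close>; once both
  \<open>(x \<odot> a) \<odot> c\<^sup>k\<close> and \<open>(x \<odot> b) \<odot> c\<^sup>k\<close> lie in \<open>I\<close>, the colon ideal of
  \<open>x \<odot> c\<^sup>k\<close> contains \<open>a\<close> and \<open>b\<close>, hence \<open>c\<close>.\<close>

lemma ten_power_in_ideal:
  assumes I: "thick_tensor_ideal C M I" and ob: "a \<in> Ob C" "b \<in> Ob C" "c \<in> Ob C"
    and c: "\<And>J. thick_tensor_ideal C M J \<Longrightarrow> a \<in> J \<Longrightarrow> b \<in> J \<Longrightarrow> c \<in> J"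
    and "x \<in> Ob C" "x \<odot> tensor_power M a n \<in> I" "x \<odot> tensor_power M b m \<in> I"
  shows "\<exists>k. x \<odot> tensor_power M c k \<in> I"
  using assms(6-8)
proof (induction "n + m" arbitrary: n m x rule: less_induct)
  case less
  note x = less.prems(1)
  show ?case
  proof (cases "n = 0 \<or> m = 0")
    \<comment> \<open>A zeroth power is \<open>Unit M\<close>, so one of the two memberships is
      already the claim for \<open>k = 0\<close>.\<close>
    case True
    then have "x \<odot> tensor_power M c 0 \<in> I"
      using less.prems by auto
    then show ?thesis
      by blast
  next
    case False
    then obtain n' m' where nm: "n = Suc n'" "m = Suc m'"
      by (metis not0_implies_Suc)
    have "(x \<odot> a) \<odot> tensor_power M a n' \<in> I"
      by (rule ideal_iso_class[OF I less.prems(2)])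
        (use x ob nm in \<open>simp_all add: iso.m_ac\<close>)
    moreover have "(x \<odot> a) \<odot> tensor_power M b m \<in> I"
      by (rule ideal_iso_class[OF I ideal_ten_right[OF I less.prems(3) ob(1)]])
        (use x ob in \<open>simp_all add: iso.m_ac\<close>)
    ultimately obtain k where k: "(x \<odot> a) \<odot> tensor_power M c k \<in> I"
      using less.hyps[of n' m "x \<odot> a"] nm x ob by auto
    have "(x \<odot> b) \<odot> tensor_power M b m' \<in> I"
      by (rule ideal_iso_class[OF I less.prems(3)])
        (use x ob nm in \<open>simp_all add: iso.m_ac\<close>)
    moreover have "(x \<odot> b) \<odot> tensor_power M a n \<in> I"
      by (rule ideal_iso_class[OF I ideal_ten_right[OF I less.prems(2) ob(2)]])
        (use x ob in \<open>simp_all add: iso.m_ac\<close>)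
    ultimately obtain l where l: "(x \<odot> b) \<odot> tensor_power M c l \<in> I"
      using less.hyps[of n m' "x \<odot> b"] nm x ob by auto
    \<comment> \<open>The exponent \<open>k + l\<close> is a common bound: tensoring the first
      membership with the power \<open>l\<close> of \<open>c\<close>, and the second with the power
      \<open>k\<close>, gives both factors the same cofactor \<open>?y\<close>.\<close>
    let ?y = "x \<odot> tensor_power M c (k + l)"
    have "?y \<odot> a \<in> I"
      by (rule ideal_iso_class[OF I ideal_ten_right[OF I k tensor_power_closed[OF ob(3), of l]]])
        (use x ob in \<open>simp_all add: iso.m_ac iso.nat_pow_mult[symmetric]\<close>)
    moreover have "?y \<odot> b \<in> I"
      by (rule ideal_iso_class[OF I ideal_ten_right[OF I l tensor_power_closed[OF ob(3), of k]]])
        (use x ob in \<open>simp_all add: iso.m_ac iso.nat_pow_mult[symmetric]\<close>)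
    ultimately have "c \<in> colon I ?y"
      using c[OF thick_tensor_ideal_colon[OF I, of ?y]] x ob by (simp add: colon_def)
    then have "?y \<odot> c \<in> I"
      by (simp add: colon_def)
    then have "x \<odot> tensor_power M c (Suc (k + l)) \<in> I"
      by (rule ideal_iso_class[OF I]) (use x ob in \<open>simp_all add: iso.m_ac\<close>)
    then show ?thesis
      by blast
  qed
qed

lemma ideal_subset_radical:
  assumes "thick_tensor_ideal C M I"
  shows "I \<subseteq> radical C M I"
proof
  fix a assume a: "a \<in> I"
  then have "a \<in> Ob C"
    using ideal_subset[OF assms] by blast
  \<comment> \<open>The first power unfolds to \<open>Unit M \<odot> a\<close>, not to
    \<open>a\<close> itself.\<close>
  then have "tensor_power M a 1 \<in> I"
    using ideal_ten_left[OF assms a Unit_closed] by simp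
  then show "a \<in> radical C M I"
    using \<open>a \<in> Ob C\<close> unfolding radical_def by blast
qed

text \<open>By the pair criterion it is enough to bound a power of \<open>c\<close> in terms of
  powers of \<open>a\<close> and \<open>b\<close>, which is \<open>ten_power_in_ideal\<close> at
  \<open>x = Unit M\<close>.\<close>

lemma thick_tensor_ideal_radical:
  assumes I: "thick_tensor_ideal C M I"
  shows "thick_tensor_ideal C M (radical C M I)"
proof (rule thick_tensor_idealI)
  show "radical C M I \<subseteq> Ob C"
    by (auto simp: radical_def)
  show "radical C M I \<noteq> {}"
    using ideal_subset_radical[OF I] zero_object_exists ideal_zero_object[OF I] by blast
next
  fix a b c
  assume "a \<in> radical C M I" "b \<in> radical C M I"
    and c: "\<And>J. thick_tensor_ideal C M J \<Longrightarrow> a \<in> J \<Longrightarrow> b \<in> J \<Longrightarrow> c \<in> J"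
  then obtain n m where ob: "a \<in> Ob C" "b \<in> Ob C"
    and "tensor_power M a n \<in> I" "tensor_power M b m \<in> I"
    by (auto simp: radical_def)
  then have nm: "Unit M \<odot> tensor_power M a n \<in> I" "Unit M \<odot> tensor_power M b m \<in> I"
    using ideal_ten_left[OF I] Unit_closed by blast+
  \<comment> \<open>The hypothesis on \<open>c\<close> is instantiated with the ideal of all
    objects.\<close>
  have "c \<in> Ob C"
    using c[OF thick_tensor_ideal_Ob] ob by blast
  then obtain k where "Unit M \<odot> tensor_power M c k \<in> I"
    using ten_power_in_ideal[OF I ob _ c Unit_closed nm] by blast
  then have "tensor_power M c k \<in> I"
    by (rule ideal_iso[OF I]) (use \<open>c \<in> Ob C\<close> ten_unit_iso in auto)
  then show "c \<in> radical C M I"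
    using \<open>c \<in> Ob C\<close> unfolding radical_def by blast
qed

text \<open>Only one inclusion has to be checked, as an ideal always lies in its radical.\<close>

lemma radical_thick_tensor_idealI:
  assumes "thick_tensor_ideal C M I"
    and "\<And>a n. a \<in> Ob C \<Longrightarrow> tensor_power M a n \<in> I \<Longrightarrow> a \<in> I"
  shows "radical_thick_tensor_ideal C M I"
  unfolding radical_thick_tensor_ideal_def
  using assms ideal_subset_radical[OF assms(1)] by (auto simp: radical_def)

lemma radical_thick: "radical_thick_tensor_ideal C M I \<Longrightarrow> thick_tensor_ideal C M I"
  by (simp add: radical_thick_tensor_ideal_def)

lemma radical_powerD:
  "radical_thick_tensor_ideal C M I \<Longrightarrow> a \<in> Ob C \<Longrightarrow> tensor_power M a n \<in> I \<Longrightarrow> a \<in> I"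
  unfolding radical_thick_tensor_ideal_def radical_def by blast

text \<open>Closes the colon arguments below, which end with a tensor square in the ideal.\<close>

lemma radical_squareD:
  assumes I: "radical_thick_tensor_ideal C M I" and a: "a \<in> Ob C" "a \<odot> a \<in> I"
  shows "a \<in> I"
proof (rule radical_powerD[OF I a(1), of 2])
  show "tensor_power M a 2 \<in> I"
    by (rule ideal_iso_class[OF radical_thick[OF I] a(2)])
      (use a in \<open>simp_all add: numeral_2_eq_2\<close>)
qed

text \<open>A power of a power of \<open>a\<close> is a power of \<open>a\<close>, with the
  exponents multiplied.\<close>

lemma radical_thick_tensor_ideal_radical:
  assumes I: "thick_tensor_ideal C M I"
  shows "radical_thick_tensor_ideal C M (radical C M I)"
proof (rule radical_thick_tensor_idealI[OF thick_tensor_ideal_radical[OF I]])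
  fix a n assume a: "a \<in> Ob C" and "tensor_power M a n \<in> radical C M I"
  then obtain m where "tensor_power M (tensor_power M a n) m \<in> I"
    by (auto simp: radical_def)
  then have "tensor_power M a (n * m) \<in> I"
    by (rule ideal_iso_class[OF I]) (use a in \<open>simp_all add: iso.nat_pow_pow\<close>)
  then show "a \<in> radical C M I"
    using a unfolding radical_def by blast
qed

text \<open>If \<open>x \<odot> tensor_power M a n\<close> lies in \<open>I\<close>, multiplying by
  the \<open>n\<close>-th power of \<open>x\<close> and once more by \<open>a\<close> gives the
  power \<open>Suc n\<close> of \<open>x \<odot> a\<close>, and radicality removes the
  exponent.\<close>

lemma radical_thick_tensor_ideal_colon:
  assumes I: "radical_thick_tensor_ideal C M I" and x: "x \<in> Ob C"
  shows "radical_thick_tensor_ideal C M (colon I x)"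
proof (rule radical_thick_tensor_idealI[OF thick_tensor_ideal_colon[OF radical_thick[OF I] x]])
  note thick = radical_thick[OF I]
  fix a n assume a: "a \<in> Ob C" and "tensor_power M a n \<in> colon I x"
  then have "x \<odot> tensor_power M a n \<in> I"
    by (simp add: colon_def)
  then have "(x \<odot> tensor_power M a n) \<odot> tensor_power M x n \<in> I"
    using ideal_ten_right[OF thick] x by simp
  then have "x \<odot> tensor_power M (x \<odot> a) n \<in> I"
    by (rule ideal_iso_class[OF thick]) (use x a in \<open>simp_all add: iso.m_ac iso.nat_pow_distrib\<close>)
  then have "(x \<odot> tensor_power M (x \<odot> a) n) \<odot> a \<in> I"
    using ideal_ten_right[OF thick] a by simp
  then have "tensor_power M (x \<odot> a) (Suc n) \<in> I"
    by (rule ideal_iso_class[OF thick]) (use x a in \<open>simp_all add: iso.m_ac iso.nat_pow_distrib\<close>)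
  then show "a \<in> colon I x"
    using radical_powerD[OF I ten_closed[OF x a]] a by (simp only: colon_def mem_Collect_eq)
qed

lemma radical_thick_tensor_ideal_Ob: "radical_thick_tensor_ideal C M (Ob C)"
  using thick_tensor_ideal_Ob by (rule radical_thick_tensor_idealI)

lemma radical_thick_tensor_ideal_Inter:
  assumes "\<I> \<noteq> {}" "\<And>I. I \<in> \<I> \<Longrightarrow> radical_thick_tensor_ideal C M I"
  shows "radical_thick_tensor_ideal C M (\<Inter>\<I>)"
proof (rule radical_thick_tensor_idealI)
  show "thick_tensor_ideal C M (\<Inter>\<I>)"
    using assms radical_thick by (intro thick_tensor_ideal_Inter) blast+
qed (use assms radical_powerD in blast)

section \<open>Radical ideals generated by sets of objects\<close>

definition rad :: "'o set \<Rightarrow> 'o set" where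
  "rad S = radical C M (generated_ideal C M S)"

lemma principal_radical_eq_rad: "principal_radical C M a = rad {a}"
  by (simp add: principal_radical_def rad_def)

lemma radical_thick_rad: "S \<subseteq> Ob C \<Longrightarrow> radical_thick_tensor_ideal C M (rad S)"
  unfolding rad_def by (intro radical_thick_tensor_ideal_radical thick_generated_ideal)

lemma subset_rad: "S \<subseteq> Ob C \<Longrightarrow> S \<subseteq> rad S"
  unfolding rad_def
  using subset_generated_ideal ideal_subset_radical[OF thick_generated_ideal] by blast

text \<open>Together with \<open>radical_thick_rad\<close> and \<open>subset_rad\<close> this is the
  universal property of \<open>rad\<close>; nearly all later inclusions follow from it.\<close>

lemma rad_least:
  assumes "radical_thick_tensor_ideal C M J" "S \<subseteq> J"
  shows "rad S \<subseteq> J"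
  using generated_ideal_least[OF radical_thick[OF assms(1)] assms(2)] radical_powerD[OF assms(1)]
  unfolding rad_def radical_def by blast

lemma rad_mono:
  assumes "S \<subseteq> T" "T \<subseteq> Ob C"
  shows "rad S \<subseteq> rad T"
  using assms subset_rad[OF assms(2)] by (intro rad_least radical_thick_rad) auto

lemma rad_le_iff:
  "S \<subseteq> Ob C \<Longrightarrow> radical_thick_tensor_ideal C M J \<Longrightarrow> rad S \<subseteq> J \<longleftrightarrow> S \<subseteq> J"
  using rad_least subset_rad by blast

text \<open>For the harder inclusion two colon ideals are used in turn: with
  \<open>J = rad {a \<odot> b}\<close>, the ideal \<open>colon J b\<close> contains
  \<open>a\<close>, hence \<open>x\<close>; then \<open>colon J x\<close> contains \<open>b\<close>,
  hence \<open>x\<close>. So the square of \<open>x\<close> lies in \<open>J\<close>.\<close>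

lemma rad_ten:
  assumes a: "a \<in> Ob C" and b: "b \<in> Ob C"
  shows "rad {a \<odot> b} = rad {a} \<inter> rad {b}"
proof
  have "a \<odot> b \<in> rad {a}" "a \<odot> b \<in> rad {b}"
    using ideal_ten_right[OF radical_thick[OF radical_thick_rad], of "{a}" a b]
      ideal_ten_left[OF radical_thick[OF radical_thick_rad], of "{b}" b a]
      subset_rad[of "{a}"] subset_rad[of "{b}"] a b by auto
  then show "rad {a \<odot> b} \<subseteq> rad {a} \<inter> rad {b}"
    using radical_thick_rad a b by (simp add: rad_le_iff)
  show "rad {a} \<inter> rad {b} \<subseteq> rad {a \<odot> b}"
  proof
    fix x assume x: "x \<in> rad {a} \<inter> rad {b}"
    let ?J = "rad {a \<odot> b}"
    have J: "radical_thick_tensor_ideal C M ?J"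
      using radical_thick_rad a b by simp
    note thick = radical_thick[OF J]
    have x_ob: "x \<in> Ob C"
      using x ideal_subset[OF radical_thick[OF radical_thick_rad]] a by blast
    have "a \<odot> b \<in> ?J"
      using subset_rad[of "{a \<odot> b}"] a b by simp
    then have "b \<odot> a \<in> ?J"
      using ideal_iso[OF thick _ ten_comm_iso] a b by simp
    then have "rad {a} \<subseteq> colon ?J b"
      using rad_least[OF radical_thick_tensor_ideal_colon[OF J b]] a by (simp add: colon_def)
    then have "b \<odot> x \<in> ?J"
      using x by (auto simp: colon_def)
    then have "x \<odot> b \<in> ?J"
      using ideal_iso[OF thick _ ten_comm_iso] x_ob b by simp
    then have "rad {b} \<subseteq> colon ?J x"
      using rad_least[OF radical_thick_tensor_ideal_colon[OF J x_ob]] b by (simp add: colon_def)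
    then have "x \<odot> x \<in> ?J"
      using x by (auto simp: colon_def)
    then show "x \<in> ?J"
      using radical_squareD[OF J x_ob] by blast
  qed
qed

text \<open>An ideal contains a direct sum exactly when it contains both summands, so generators can
  be merged one at a time, starting from a zero object.\<close>

lemma rad_finite_principal:
  assumes "finite S" "S \<subseteq> Ob C"
  shows "\<exists>s \<in> Ob C. rad S = rad {s}"
  using assms
proof (induction S)
  case empty
  obtain z where z: "zero_object C z"
    using zero_object_exists by blast
  then have "z \<in> Ob C"
    by (simp add: zero_object_def)
  moreover have "z \<in> rad {}"
    using ideal_zero_object[OF radical_thick[OF radical_thick_rad] z] by simp
  ultimately show ?case
    using rad_least[OF radical_thick_rad, of "{}" "{z}"] rad_mono[of "{}" "{z}"] by blast
next
  case (insert a S)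
  then obtain t where t: "t \<in> Ob C" "rad S = rad {t}"
    by auto
  obtain s where s: "biproduct C a t s"
    using biproduct_exists insert.prems t by blast
  then have ob: "s \<in> Ob C"
    by (auto simp: biproduct_def)
  \<comment> \<open>Two generated radical ideals agree once the same radical ideals contain their
    generators.\<close>
  have "s \<in> J \<longleftrightarrow> insert a S \<subseteq> J" if J: "radical_thick_tensor_ideal C M J" for J
    using ideal_sum[OF radical_thick[OF J] s] rad_le_iff[OF _ J, of S] rad_le_iff[OF _ J, of "{t}"]
      t insert.prems by simp
  then have "rad (insert a S) \<subseteq> J \<longleftrightarrow> rad {s} \<subseteq> J" if "radical_thick_tensor_ideal C M J" for J
    using rad_le_iff that ob insert.prems by simp
  then have "rad (insert a S) = rad {s}"
    using radical_thick_rad[of "{s}"] radical_thick_rad[of "insert a S"] ob insert.prems by blast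
  then show ?case
    using ob by blast
qed

text \<open>Two members of the union already lie in a common ideal of the family, which is all that
  the pair criterion asks for.\<close>

lemma radical_directed_Union:
  assumes "\<I> \<noteq> {}" and rad: "\<And>I. I \<in> \<I> \<Longrightarrow> radical_thick_tensor_ideal C M I"
    and dir: "\<And>I J. I \<in> \<I> \<Longrightarrow> J \<in> \<I> \<Longrightarrow> \<exists>K \<in> \<I>. I \<subseteq> K \<and> J \<subseteq> K"
  shows "radical_thick_tensor_ideal C M (\<Union>\<I>)"
proof (rule radical_thick_tensor_idealI[OF thick_tensor_idealI])
  show "\<Union>\<I> \<subseteq> Ob C"
    using rad radical_thick ideal_subset by blast
  show "\<Union>\<I> \<noteq> {}"
    using assms(1) rad radical_thick zero_object_exists ideal_zero_object by blast
next
  fix a b c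
  assume "a \<in> \<Union>\<I>" "b \<in> \<Union>\<I>"
    and c: "\<And>J. thick_tensor_ideal C M J \<Longrightarrow> a \<in> J \<Longrightarrow> b \<in> J \<Longrightarrow> c \<in> J"
  then obtain K where "K \<in> \<I>" "a \<in> K" "b \<in> K"
    using dir by blast
  then show "c \<in> \<Union>\<I>"
    using c[OF radical_thick[OF rad]] by blast
next
  fix a n assume "a \<in> Ob C" "tensor_power M a n \<in> \<Union>\<I>"
  then show "a \<in> \<Union>\<I>"
    using radical_powerD rad by blast
qed

text \<open>The source of compactness. The ideals on the right are directed, with
  \<open>K \<union> L\<close> giving an upper bound, so their union is a radical ideal; it contains
  \<open>\<Union>S\<close> by taking singletons for \<open>K\<close>.\<close>

lemma rad_Union_finite:
  assumes S: "\<Union>S \<subseteq> Ob C"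
  shows "rad (\<Union>S) = \<Union>{rad (\<Union>K) | K. finite K \<and> K \<subseteq> S}" (is "_ = \<Union>?H")
proof
  have sub: "\<Union>K \<subseteq> Ob C" if "K \<subseteq> S" for K
    using S that by blast
  have "radical_thick_tensor_ideal C M (\<Union>?H)"
  proof (rule radical_directed_Union)
    have "rad (\<Union>{}) \<in> ?H"
      by blast
    then show "?H \<noteq> {}"
      by blast
  next
    fix I assume "I \<in> ?H"
    then show "radical_thick_tensor_ideal C M I"
      using radical_thick_rad[OF sub] by blast
  next
    fix I J assume "I \<in> ?H" "J \<in> ?H"
    then obtain K L where *: "finite K" "K \<subseteq> S" "I = rad (\<Union>K)" "finite L" "L \<subseteq> S" "J = rad (\<Union>L)"
      by blast
    then have "rad (\<Union>(K \<union> L)) \<in> ?H"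
      using finite_UnI Un_least by blast
    moreover have "I \<subseteq> rad (\<Union>(K \<union> L))" "J \<subseteq> rad (\<Union>(K \<union> L))"
      using * sub[of "K \<union> L"] by (simp_all add: rad_mono)
    ultimately show "\<exists>K \<in> ?H. I \<subseteq> K \<and> J \<subseteq> K"
      by blast
  qed
  moreover have "\<Union>S \<subseteq> \<Union>?H"
  proof
    fix x assume "x \<in> \<Union>S"
    then obtain A where A: "A \<in> S" "x \<in> A"
      by blast
    then have "x \<in> rad (\<Union>{A})"
      using subset_rad[OF sub[of "{A}"]] by auto
    then show "x \<in> \<Union>?H"
      using A by blast
  qed
  ultimately show "rad (\<Union>S) \<subseteq> \<Union>?H"
    by (rule rad_least)
  show "\<Union>?H \<subseteq> rad (\<Union>S)"
    using rad_mono[OF Union_mono S] by blast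
qed

section \<open>The frame of radical thick tensor ideals\<close>

abbreviation rad_order :: "'o set gorder" where
  "rad_order \<equiv> radical_ideal_order C M"

lemma carrier_rad_order [simp]: "carrier rad_order = {I. radical_thick_tensor_ideal C M I}"
  and le_rad_order [simp]: "I \<sqsubseteq>\<^bsub>rad_order\<^esub> J \<longleftrightarrow> I \<subseteq> J"
  by (simp_all add: radical_ideal_order_def)

text \<open>A greatest element and infima of nonempty families suffice; these infima are
  intersections.\<close>

lemma complete_lattice_rad_order: "complete_lattice rad_order"
proof -
  interpret partial_order rad_order
    by standard (auto simp: radical_ideal_order_def)
  show ?thesis
  proof (rule complete_lattice_criterion1)
    have "greatest rad_order (Ob C) (carrier rad_order)"
      using radical_thick_tensor_ideal_Ob ideal_subset[OF radical_thick] by (auto simp: greatest_def)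
    then show "\<exists>g. greatest rad_order g (carrier rad_order)" ..
  next
    fix A assume A: "A \<subseteq> carrier rad_order" "A \<noteq> {}"
    then have "radical_thick_tensor_ideal C M (\<Inter>A)"
      by (intro radical_thick_tensor_ideal_Inter) auto
    then have "greatest rad_order (\<Inter>A) (Lower rad_order A)"
      using A by (auto simp: greatest_def Lower_def)
    then show "\<exists>i. greatest rad_order i (Lower rad_order A)" ..
  qed
qed

sublocale order: complete_lattice rad_order
  by (rule complete_lattice_rad_order)

lemma Union_subset_Ob: "A \<subseteq> carrier rad_order \<Longrightarrow> \<Union>A \<subseteq> Ob C"
  using ideal_subset radical_thick by fastforce

lemma Sup_rad_order:
  assumes A: "A \<subseteq> carrier rad_order"
  shows "\<Squnion>\<^bsub>rad_order\<^esub>A = rad (\<Union>A)"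
proof
  have "rad (\<Union>A) \<in> carrier rad_order"
    using radical_thick_rad[OF Union_subset_Ob[OF A]] by simp
  then show "\<Squnion>\<^bsub>rad_order\<^esub>A \<subseteq> rad (\<Union>A)"
    using order.sup_least[OF A] subset_rad[OF Union_subset_Ob[OF A]] by auto
  have "\<Union>A \<subseteq> \<Squnion>\<^bsub>rad_order\<^esub>A"
    using order.sup_upper[OF A] by auto
  then show "rad (\<Union>A) \<subseteq> \<Squnion>\<^bsub>rad_order\<^esub>A"
    using order.sup_closed[OF A] by (intro rad_least) auto
qed

lemma meet_rad_order:
  assumes "I \<in> carrier rad_order" "J \<in> carrier rad_order"
  shows "I \<sqinter>\<^bsub>rad_order\<^esub> J = I \<inter> J"
proof
  show "I \<sqinter>\<^bsub>rad_order\<^esub> J \<subseteq> I \<inter> J"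
    using order.meet_left[OF assms] order.meet_right[OF assms] by simp
  have "I \<inter> J \<in> carrier rad_order"
    using radical_thick_tensor_ideal_Inter[of "{I, J}"] assms by auto
  then show "I \<inter> J \<subseteq> I \<sqinter>\<^bsub>rad_order\<^esub> J"
    using order.meet_le[of "I \<inter> J" I J] assms by simp
qed

text \<open>Lets a join be computed on generators; with singletons, a join of principal ideals
  becomes \<open>rad\<close> of a set of objects.\<close>

lemma rad_Union_rad:
  assumes "\<Union>\<S> \<subseteq> Ob C"
  shows "rad (\<Union>(rad ` \<S>)) = rad (\<Union>\<S>)"
proof
  have sub: "\<Union>\<S> \<subseteq> Ob C" "\<Union>(rad ` \<S>) \<subseteq> Ob C"
    using assms ideal_subset[OF radical_thick[OF radical_thick_rad]] by blast+
  have "rad S \<subseteq> rad (\<Union>\<S>)" if "S \<in> \<S>" for S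
    using rad_mono[of S "\<Union>\<S>"] sub that by blast
  then show "rad (\<Union>(rad ` \<S>)) \<subseteq> rad (\<Union>\<S>)"
    using rad_least[OF radical_thick_rad[OF sub(1)]] by blast
  have "\<Union>\<S> \<subseteq> \<Union>(rad ` \<S>)"
    using subset_rad assms by blast
  then show "rad (\<Union>\<S>) \<subseteq> rad (\<Union>(rad ` \<S>))"
    using rad_mono sub by blast
qed

text \<open>For \<open>J = \<Squnion>(x \<sqinter> a)\<close>, the colon ideal of \<open>y \<in> x\<close> contains every \<open>a\<close>, hence also
  \<open>y\<close> if \<open>y \<in> \<Squnion>a\<close>; then \<open>y \<odot> y \<in> J\<close> and \<open>y \<in> J\<close>.\<close>

lemma frame_rad_order: "frame rad_order"
proof
  fix I A assume I: "I \<in> carrier rad_order" and A: "A \<subseteq> carrier rad_order"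
  let ?B = "(\<lambda>a. I \<sqinter>\<^bsub>rad_order\<^esub> a) ` A"
  have B: "?B \<subseteq> carrier rad_order"
    using order.meet_closed[OF I] A by blast
  let ?J = "\<Squnion>\<^bsub>rad_order\<^esub>?B"
  have J: "radical_thick_tensor_ideal C M ?J"
    using order.sup_closed[OF B] by simp
  have IJ: "I \<inter> K \<subseteq> ?J" if "K \<in> A" for K
    using order.sup_upper[OF B, of "I \<sqinter>\<^bsub>rad_order\<^esub> K"] meet_rad_order[OF I, of K] A that by auto
  have "I \<inter> \<Squnion>\<^bsub>rad_order\<^esub>A \<subseteq> ?J"
  proof
    fix y assume y: "y \<in> I \<inter> \<Squnion>\<^bsub>rad_order\<^esub>A"
    have I': "thick_tensor_ideal C M I"
      using I radical_thick by simp
    have y_ob: "y \<in> Ob C"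
      using y ideal_subset[OF I'] by blast
    have "\<Union>A \<subseteq> colon ?J y"
    proof
      fix s assume "s \<in> \<Union>A"
      then obtain K where K: "K \<in> A" "s \<in> K"
        by blast
      then have K': "thick_tensor_ideal C M K"
        using A radical_thick by auto
      have s: "s \<in> Ob C"
        using ideal_subset[OF K' K(2)] .
      have "y \<odot> s \<in> I \<inter> K"
        using ideal_ten_right[OF I' _ s] ideal_ten_left[OF K' K(2) y_ob] y by blast
      then show "s \<in> colon ?J y"
        using IJ[OF K(1)] s by (auto simp: colon_def)
    qed
    then have "\<Squnion>\<^bsub>rad_order\<^esub>A \<subseteq> colon ?J y"
      unfolding Sup_rad_order[OF A] by (rule rad_least[OF radical_thick_tensor_ideal_colon[OF J y_ob]])
    then have "y \<odot> y \<in> ?J"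
      using y by (auto simp: colon_def)
    then show "y \<in> ?J"
      by (rule radical_squareD[OF J y_ob])
  qed
  moreover have "?J \<subseteq> I \<inter> \<Squnion>\<^bsub>rad_order\<^esub>A"
  proof -
    have "K \<subseteq> I \<inter> \<Squnion>\<^bsub>rad_order\<^esub>A" if "K \<in> ?B" for K
      using that meet_rad_order[OF I] order.sup_upper[OF A] A by auto
    moreover have "radical_thick_tensor_ideal C M (I \<inter> \<Squnion>\<^bsub>rad_order\<^esub>A)"
      using radical_thick_tensor_ideal_Inter[of "{I, \<Squnion>\<^bsub>rad_order\<^esub>A}"] I order.sup_closed[OF A]
      by auto
    ultimately show ?thesis
      using order.sup_least[OF B, of "I \<inter> \<Squnion>\<^bsub>rad_order\<^esub>A"] by simp
  qed
  ultimately show "I \<sqinter>\<^bsub>rad_order\<^esub> \<Squnion>\<^bsub>rad_order\<^esub>A = ?J"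
    using meet_rad_order[OF I order.sup_closed[OF A]] by (simp only: subset_antisym)
qed

text \<open>Any \<open>c\<close> is the join of the principal ideals of its members, so a finite
  \<open>c\<close> needs finitely many of them, and these merge into one. Conversely,
  \<open>rad {a}\<close> lies below a join as soon as \<open>a\<close> does, and that involves
  finitely many joined ideals.\<close>

lemma finite_elements_rad_order: "finite_elements rad_order = {rad {a} | a. a \<in> Ob C}"
proof (intro equalityI subsetI)
  fix c assume c: "c \<in> finite_elements rad_order"
  then have c_rad: "radical_thick_tensor_ideal C M c"
    by (simp add: finite_elements_def)
  then have c_ob: "c \<subseteq> Ob C"
    using ideal_subset[OF radical_thick] by blast
  have S: "(\<lambda>a. rad {a}) ` c \<subseteq> carrier rad_order"
    using radical_thick_rad c_ob by auto
  have "c \<subseteq> \<Squnion>\<^bsub>rad_order\<^esub>((\<lambda>a. rad {a}) ` c)"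
  proof
    fix a assume a: "a \<in> c"
    then have "a \<in> rad {a}"
      using subset_rad[of "{a}"] c_ob by blast
    then show "a \<in> \<Squnion>\<^bsub>rad_order\<^esub>((\<lambda>a. rad {a}) ` c)"
      using order.sup_upper[OF S, of "rad {a}"] a by auto
  qed
  then obtain K where K: "K \<subseteq> (\<lambda>a. rad {a}) ` c" "finite K" "c \<subseteq> \<Squnion>\<^bsub>rad_order\<^esub>K"
    using c S unfolding finite_elements_def by auto
  \<comment> \<open>The finite subfamily is pulled back to a finite set of generators inside
    \<open>c\<close>.\<close>
  then obtain F where F: "F \<subseteq> c" "finite F" "K = (\<lambda>a. rad {a}) ` F"
    by (meson finite_subset_image)
  have "\<Squnion>\<^bsub>rad_order\<^esub>K = rad F"
    using Sup_rad_order[OF subset_trans[OF K(1) S]] rad_Union_rad[of "(\<lambda>a. {a}) ` F"] F c_ob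
    by (auto simp: image_image)
  then have "c = rad F"
    using K(3) rad_least[OF c_rad F(1)] by blast
  then show "c \<in> {rad {a} | a. a \<in> Ob C}"
    using rad_finite_principal[OF F(2)] F(1) c_ob by blast
next
  fix c assume "c \<in> {rad {a} | a. a \<in> Ob C}"
  then obtain a where a: "a \<in> Ob C" "c = rad {a}"
    by blast
  then have c: "c \<in> carrier rad_order"
    using radical_thick_rad by simp
  have "\<exists>K \<subseteq> S. finite K \<and> c \<subseteq> \<Squnion>\<^bsub>rad_order\<^esub>K"
    if S: "S \<subseteq> carrier rad_order" and "c \<subseteq> \<Squnion>\<^bsub>rad_order\<^esub>S" for S
  proof -
    have "a \<in> rad (\<Union>S)"
      using that Sup_rad_order[OF S] subset_rad[of "{a}"] a by auto
    then obtain K where K: "K \<subseteq> S" "finite K" "a \<in> rad (\<Union>K)"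
      using rad_Union_finite[OF Union_subset_Ob[OF S]] by blast
    have "K \<subseteq> carrier rad_order"
      using K(1) S by blast
    then have "c \<subseteq> \<Squnion>\<^bsub>rad_order\<^esub>K"
      using K(3) a rad_least[OF radical_thick_rad[OF Union_subset_Ob]] Sup_rad_order by simp
    then show ?thesis
      using K by blast
  qed
  then show "c \<in> finite_elements rad_order"
    using c by (simp add: finite_elements_def)
qed

text \<open>Every object is isomorphic to its tensor product with the unit; hence the top element is
  principal.\<close>

lemma rad_Unit: "rad {Unit M} = Ob C"
proof
  have J: "thick_tensor_ideal C M (rad {Unit M})"
    using radical_thick[OF radical_thick_rad] by simp
  then show "rad {Unit M} \<subseteq> Ob C"
    using ideal_subset by blast
  have "Unit M \<in> rad {Unit M}"
    using subset_rad[of "{Unit M}"] by simp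
  then show "Ob C \<subseteq> rad {Unit M}"
    using ideal_iso[OF J ideal_ten_right[OF J] ten_unit_iso] by blast
qed

lemma coherent_frame_rad_order: "coherent_frame rad_order"
proof -
  interpret frame rad_order
    by (rule frame_rad_order)
  show ?thesis
  proof
    fix I assume I: "I \<in> carrier rad_order"
    then have ob: "I \<subseteq> Ob C"
      using ideal_subset[OF radical_thick] by auto
    have A: "(\<lambda>a. rad {a}) ` I \<subseteq> finite_elements rad_order"
      using ob by (auto simp: finite_elements_rad_order)
    have "(\<lambda>a. rad {a}) ` I \<subseteq> carrier rad_order"
      using radical_thick_rad ob by auto
    then have "\<Squnion>\<^bsub>rad_order\<^esub>((\<lambda>a. rad {a}) ` I) = rad I"
      using Sup_rad_order rad_Union_rad[of "(\<lambda>a. {a}) ` I"] ob by (auto simp: image_image)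
    moreover have "rad I = I"
      using rad_least[of I I] subset_rad[OF ob] I by auto
    ultimately show "\<exists>A \<subseteq> finite_elements rad_order. I = \<Squnion>\<^bsub>rad_order\<^esub>A"
      using A by metis
  next
    \<comment> \<open>The bottom element already lies below the empty join.\<close>
    show "\<bottom>\<^bsub>rad_order\<^esub> \<in> finite_elements rad_order"
      using order.bottom_closed order.bottom_lower order.sup_closed[of "{}"]
      by (auto simp: finite_elements_def)
  next
    have "\<top>\<^bsub>rad_order\<^esub> = Ob C"
      using order.top_closed order.top_higher[of "Ob C"] radical_thick_tensor_ideal_Ob
        ideal_subset[OF radical_thick] by auto
    then show "\<top>\<^bsub>rad_order\<^esub> \<in> finite_elements rad_order"
      using rad_Unit Unit_closed by (auto simp: finite_elements_rad_order)
  next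
    fix I J assume "I \<in> finite_elements rad_order" "J \<in> finite_elements rad_order"
    then obtain a b where ab: "a \<in> Ob C" "b \<in> Ob C" "I = rad {a}" "J = rad {b}"
      by (auto simp: finite_elements_rad_order)
    then have carr: "I \<in> carrier rad_order" "J \<in> carrier rad_order"
      using radical_thick_rad by simp_all
    \<comment> \<open>A binary join is the supremum of a pair, so it is generated by the two
      objects, which \<open>rad_finite_principal\<close> then replaces by one.\<close>
    have "I \<squnion>\<^bsub>rad_order\<^esub> J = rad {a, b}"
      using Sup_rad_order[of "{I, J}"] rad_Union_rad[of "{{a}, {b}}"] ab carr
      by (simp add: join_def insert_commute)
    then show "I \<squnion>\<^bsub>rad_order\<^esub> J \<in> finite_elements rad_order"
      using rad_finite_principal[of "{a, b}"] ab by (auto simp: finite_elements_rad_order)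
    have "I \<sqinter>\<^bsub>rad_order\<^esub> J = rad {a \<odot> b}"
      using meet_rad_order[OF carr] rad_ten ab by simp
    then show "I \<sqinter>\<^bsub>rad_order\<^esub> J \<in> finite_elements rad_order"
      using ab ten_closed by (auto simp: finite_elements_rad_order)
  qed
qed

end

theorem theorem3p1p9:
  fixes C :: "('o, 'm, 'z) tri_cat_scheme"
    and M :: "('o, 'm, 'y) monoidal_structure_scheme"
  assumes "tensor_triangulated_category C M"
  shows "coherent_frame (radical_ideal_order C M) \<and>
    finite_elements (radical_ideal_order C M) = {principal_radical C M a | a. a \<in> Ob C}"
proof -
  interpret tensor_triangulated_category C M
    by fact
  show ?thesis
    using coherent_frame_rad_order finite_elements_rad_order
    by (simp only: principal_radical_eq_rad)
qed

end
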